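(* Let $m\ge1$ and let $\mathscr{M}$ be a collection of $m\times m$ stochastic matrices. If $\mathscr{M}$ is absolutely asymptotically stable, then its zero-flow graph $G_0(\mathscr{M})$ is cycle-free.
   Context: $[m]=\{1,\dots,m\}$; $S\subset[m]$ denotes a proper subset, and $\bar S=[m]\setminus S$. A matrix is stochastic if its entries are nonnegative and each row sums to $1$. A vector is stochastic if its entries are nonnegative and sum to $1$; $e$ is the all-ones column vector. For $k>s\ge 0$, $A(k:s)=A(k-1)A(k-2)\cdots A(s)$. A sequence $\{A(k)\}_{k\ge0}$ of stochastic matrices (a chain) is ergodic if for every $s\ge0$ there is a stochastic vector $v(s)$ with $\lim_{k\to\infty}A(k:s)=e\,v(s)^T$. A chain $\{A(k)\}$ is in $\mathscr{M}$ if $A(k)\in\mathscr{M}$ for all $k\ge0$. A collection $\mathscr{M}$ of stochastic matrices is absolutely asymptotically stable if every chain in $\mathscr{M}$ is ergodic. For $S,T\subset[m]$ and a matrix $A$, $A_{TS}=\sum_{i\in T,\,j\in\bar S}A_{ij}+\sum_{i\in\bar T,\,j\in S}A_{ij}$. The zero-flow graph $G_0(\mathscr{M})$ is the directed graph whose vertex set is the set of all subsets of $[m]$ and whose edge set is $$\mathcal E_0(\mathscr{M})=\{(S,T)\mid S,T\subset[m],\ |S|=|T|\ne0,\ \inf_{A\in\mathscr{M}}A_{TS}=0\}.$$ A cycle in a directed graph is a sequence $u_0\to u_1\to\cdots\to u_{r-1}\to u_r=u_0$, $r\ge1$, of edges with $u_0,\dots,u_{r-1}$ distinct; a loop $(v,v)$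 is a cycle. A directed graph is cycle-free if it contains no cycle. *)

theory Defs
  imports "HOL-Analysis.Analysis" "Graph_Theory.Pair_Digraph"
begin

definition stochastic_vector :: "real ^ 'm \<Rightarrow> bool" where
  "stochastic_vector v \<longleftrightarrow> (\<forall>i. 0 \<le> v $ i) \<and> (\<Sum>i\<in>UNIV. v $ i) = 1"

definition stochastic_matrix :: "real ^ 'm ^ 'm \<Rightarrow> bool" where
  "stochastic_matrix A \<longleftrightarrow> (\<forall>i j. 0 \<le> A $ i $ j) \<and> (\<forall>i. (\<Sum>j\<in>UNIV. A $ i $ j) = 1)"

(* For k > s this is A(k-1) ** ... ** A(s): later factors are multiplied on the left. *)
definition chain_product :: "(nat \<Rightarrow> real ^ 'm ^ 'm) \<Rightarrow> nat \<Rightarrow> nat \<Rightarrow> real ^ 'm ^ 'm" where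
  "chain_product A k s = fold (\<lambda>i P. A i ** P) [s..<k] (mat 1)"

(* The all-ones vector e is the unit 1 of the pointwise product on real ^ 'm. The type constraint
   makes columnvector 1 a matrix with a single column, so that the limit is the outer product. *)
definition ergodic :: "(nat \<Rightarrow> real ^ 'm ^ 'm) \<Rightarrow> bool" where
  "ergodic A \<longleftrightarrow>
     (\<forall>s. \<exists>v. stochastic_vector v \<and>
        (\<lambda>k. chain_product A k s) \<longlonglongrightarrow> (columnvector 1 :: real ^ 1 ^ 'm) ** rowvector v)"

definition absolutely_asymptotically_stable :: "(real ^ 'm ^ 'm) set \<Rightarrow> bool" where
  "absolutely_asymptotically_stable M \<longleftrightarrow>
     (\<forall>A :: nat \<Rightarrow> real ^ 'm ^ 'm. (\<forall>k. A k \<in> M) \<longrightarrow> ergodic A)"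

definition flow :: "real ^ 'm ^ 'm \<Rightarrow> 'm set \<Rightarrow> 'm set \<Rightarrow> real" where
  "flow A T S = (\<Sum>i\<in>T. \<Sum>j\<in>-S. A $ i $ j) + (\<Sum>i\<in>-T. \<Sum>j\<in>S. A $ i $ j)"

(* The arcs are restricted to proper subsets; otherwise (UNIV, UNIV) would always be a loop.
   The infimum is taken in the extended reals so that it is infinite for empty M. *)
definition zero_flow_graph :: "(real ^ 'm ^ 'm) set \<Rightarrow> 'm set pair_pre_digraph" where
  "zero_flow_graph M =
     \<lparr> pverts = UNIV,
       parcs = {(S, T). S \<subset> UNIV \<and> T \<subset> UNIV \<and> card S = card T \<and> card T \<noteq> 0 \<and>
                  (INF A\<in>M. ereal (flow A T S)) = 0} \<rparr>"

(* In pre_digraph.cycle, loops are cycles and the empty walk is not. *)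
definition cycle_free :: "('a, 'b) pre_digraph \<Rightarrow> bool" where
  "cycle_free G \<longleftrightarrow> (\<nexists>p. pre_digraph.cycle G p)"

end

theory Submission
  imports Defs
begin

text \<open>
  A matrix \<open>A\<close> acts on column vectors, and \<open>flow A T S\<close> measures how far \<open>A\<close> is from sending the
  indicator vector of \<open>S\<close> to that of \<open>T\<close>: it is the mass that the rows in \<open>T\<close> put outside \<open>S\<close>
  plus the mass that the rows outside \<open>T\<close> put into \<open>S\<close>. If the flow vanishes, the
  indicator of \<open>S\<close> is mapped exactly to the indicator of \<open>T\<close>.

  A cycle of the zero-flow graph can be traversed forever, which gives an infinite walk
  \<open>U 0, U 1, \<dots>\<close> of nonempty proper subsets. For its \<open>k\<close>-th arc the collection has a matrix
  \<open>A k\<close> whose flow is as small as desired, and the flows are taken summable with sum at most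
  \<open>1/4\<close>. Stochastic matrices do not enlarge errors in the maximum norm, so the errors only add up,
  and the product of the first \<open>k\<close> matrices maps the indicator of \<open>U 0\<close> to within \<open>1/4\<close> of the
  indicator of \<open>U k\<close> (\<open>stochastic_indicator_step\<close>). Since \<open>U k\<close> is nonempty and proper, that image
  always has two entries that differ by at least \<open>1/2\<close>. Under an ergodic chain, however, the image
  converges to a multiple of the all-ones vector (\<open>ergodic_chain_consensus\<close>).
\<close>

text \<open>The old error is averaged by row \<open>i\<close>, whose entries sum to \<open>1\<close>. The new error is the mass
  of row \<open>i\<close> on the wrong side of \<open>S\<close>, which is a summand of the flow.\<close>

lemma stochastic_indicator_step:
  fixes A :: "real ^ 'm ^ 'm"
  assumes A: "stochastic_matrix A" and flow: "flow A T S \<le> d"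
    and x: "\<And>l. \<bar>x $ l - indicator S l\<bar> \<le> e"
  shows "\<bar>(A *v x) $ i - indicator T i\<bar> \<le> e + d"
proof -
  have nonneg: "0 \<le> A $ i $ j" for i j
    using A by (simp add: stochastic_matrix_def)
  have row: "(\<Sum>j\<in>UNIV. A $ i $ j) = 1" for i
    using A by (simp add: stochastic_matrix_def)
  have "\<bar>\<Sum>l\<in>UNIV. A $ i $ l * (x $ l - indicator S l)\<bar> \<le> (\<Sum>l\<in>UNIV. A $ i $ l * e)"
    by (rule order_trans[OF sum_abs])
      (auto intro!: sum_mono mult_left_mono x simp: abs_mult nonneg)
  also have "\<dots> = e"
    by (simp add: row flip: sum_distrib_right)
  finally have propagated: "\<bar>\<Sum>l\<in>UNIV. A $ i $ l * (x $ l - indicator S l)\<bar> \<le> e" .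
  have row_S: "(\<Sum>l\<in>UNIV. A $ i $ l * indicator S l) = (\<Sum>l\<in>S. A $ i $ l)"
    by (simp add: indicator_def if_distrib sum.If_cases cong: if_cong)
  have added: "\<bar>(\<Sum>l\<in>S. A $ i $ l) - indicator T i\<bar> \<le> d"
  proof (cases "i \<in> T")
    case True
    have "(\<Sum>l\<in>S. A $ i $ l) + (\<Sum>l\<in>-S. A $ i $ l) = 1"
      using row[of i] sum.subset_diff[of S UNIV "\<lambda>l. A $ i $ l"] by (simp add: Compl_eq_Diff_UNIV)
    moreover have "(\<Sum>l\<in>-S. A $ i $ l) \<le> (\<Sum>i\<in>T. \<Sum>l\<in>-S. A $ i $ l)"
      using True by (intro member_le_sum) (auto intro: sum_nonneg nonneg)
    moreover have "0 \<le> (\<Sum>i\<in>-T. \<Sum>l\<in>S. A $ i $ l)" "0 \<le> (\<Sum>l\<in>-S. A $ i $ l)"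
      by (auto intro!: sum_nonneg nonneg)
    ultimately show ?thesis
      using flow True by (simp add: flow_def)
  next
    case False
    have "(\<Sum>l\<in>S. A $ i $ l) \<le> (\<Sum>i\<in>-T. \<Sum>l\<in>S. A $ i $ l)"
      using False by (intro member_le_sum) (auto intro: sum_nonneg nonneg)
    moreover have "0 \<le> (\<Sum>i\<in>T. \<Sum>l\<in>-S. A $ i $ l)" "0 \<le> (\<Sum>l\<in>S. A $ i $ l)"
      by (auto intro!: sum_nonneg nonneg)
    ultimately show ?thesis
      using flow False by (simp add: flow_def)
  qed
  have "(A *v x) $ i - indicator T i =
      (\<Sum>l\<in>UNIV. A $ i $ l * (x $ l - indicator S l)) + ((\<Sum>l\<in>S. A $ i $ l) - indicator T i)"
    by (simp add: matrix_vector_mult_def right_diff_distrib sum_subtractf row_S)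
  then show ?thesis
    using propagated added by linarith
qed

lemma chain_product_Suc: "chain_product A (Suc k) 0 = A k ** chain_product A k 0"
  by (simp add: chain_product_def)

lemma ergodic_chain_consensus:
  fixes A :: "nat \<Rightarrow> real ^ 'm ^ 'm"
  assumes "ergodic A"
  obtains c where "\<And>i. (\<lambda>k. (chain_product A k s *v x) $ i) \<longlonglongrightarrow> c"
proof -
  obtain v where v: "(\<lambda>k. chain_product A k s) \<longlonglongrightarrow> (columnvector 1 :: real ^ 1 ^ 'm) ** rowvector v"
    using assms by (auto simp: ergodic_def)
  have "(\<lambda>k. chain_product A k s $ i $ j) \<longlonglongrightarrow> v $ j" for i j
    using tendsto_vec_nth[OF tendsto_vec_nth[OF v], of i j]
    by (simp add: matrix_matrix_mult_def columnvector_def rowvector_def)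
  then have "(\<lambda>k. (chain_product A k s *v x) $ i) \<longlonglongrightarrow> (\<Sum>j\<in>UNIV. v $ j * x $ j)" for i
    unfolding matrix_vector_mult_def by (auto intro!: tendsto_sum tendsto_mult_right)
  then show ?thesis
    using that by blast
qed

lemma zero_flow_arc_small_flow:
  assumes "(S, T) \<in> parcs (zero_flow_graph M)" and "0 < \<epsilon>"
  obtains A where "A \<in> M" "flow A T S < \<epsilon>"
proof -
  have "(INF A\<in>M. ereal (flow A T S)) < ereal \<epsilon>"
    using assms by (simp add: zero_flow_graph_def)
  then show ?thesis
    using that by (auto simp: INF_less_iff)
qed

lemma pcas_arc_end:
  assumes "pcas u p v" "e \<in> set p"
  shows "snd e = v \<or> (\<exists>e'\<in>set p. fst e' = snd e)"
  using assms proof (induction p arbitrary: u)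
  case (Cons a p)
  then show ?case by (cases p) auto
qed simp

text \<open>Every arc of a closed walk is followed by some arc of the same walk, the last one by the first,
  so dependent choice never gets stuck.\<close>

lemma cycle_imp_infinite_walk:
  assumes "pre_digraph.cycle (with_proj G) p"
  obtains U where "\<And>k. (U k, U (Suc k)) \<in> parcs G"
proof -
  obtain u where arcs: "set p \<subseteq> parcs G" and closed: "pcas u p u" and ne: "p \<noteq> []"
    using assms by (auto simp: pre_digraph.cycle_def pre_digraph.awalk_def cas_with_proj_eq)
  have "\<exists>e'. e' \<in> set p \<and> fst e' = snd e" if "e \<in> set p" for e
    using pcas_arc_end[OF closed that] closed ne by (cases p) auto
  moreover have "\<exists>e. e \<in> set p"
    using ne by (cases p) auto
  ultimately obtain f where f: "\<And>k. f k \<in> set p" "\<And>k. fst (f (Suc k)) = snd (f k)"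
    using dependent_nat_choice[of "\<lambda>_ e. e \<in> set p" "\<lambda>_ e e'. fst e' = snd e"] by metis
  have "(fst (f k), fst (f (Suc k))) \<in> parcs G" for k
    using f arcs by (metis prod.collapse subsetD)
  then show ?thesis
    by (rule that)
qed

theorem theorem9:
  fixes M :: "(real ^ 'm ^ 'm) set"
  assumes "\<And>A. A \<in> M \<Longrightarrow> stochastic_matrix A"
    and "absolutely_asymptotically_stable M"
  shows "cycle_free (with_proj (zero_flow_graph M))"
  unfolding cycle_free_def
proof
  assume "\<exists>p. pre_digraph.cycle (with_proj (zero_flow_graph M)) p"
  then obtain U where U: "\<And>k. (U k, U (Suc k)) \<in> parcs (zero_flow_graph M)"
    using cycle_imp_infinite_walk by metis
  have "\<exists>A. A \<in> M \<and> flow A (U (Suc k)) (U k) < (1/2)^k / 8" for k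
    using zero_flow_arc_small_flow[OF U, of "(1/2)^k / 8"] by auto
  then obtain A where A: "\<And>k. A k \<in> M" "\<And>k. flow (A k) (U (Suc k)) (U k) < (1/2)^k / 8"
    by metis
  define x :: "nat \<Rightarrow> real ^ 'm"
    where "x k = chain_product A k 0 *v (\<chi> i. indicator (U 0) i)" for k
  \<comment> \<open>The bound is the sum of \<open>(1/2)^j / 8\<close> over \<open>j < k\<close>.\<close>
  have close: "\<bar>x k $ i - indicator (U k) i\<bar> \<le> (1 - (1/2)^k) / 4" for k i
  proof (induction k arbitrary: i)
    case 0
    show ?case by (simp add: x_def chain_product_def)
  next
    case (Suc k)
    have "x (Suc k) = A k *v x k"
      by (simp add: x_def chain_product_Suc matrix_vector_mul_assoc)
    then show ?case
      using stochastic_indicator_step[OF assms(1)[OF A(1)] less_imp_le[OF A(2)] Suc.IH, of i]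
      by (simp add: field_simps)
  qed
  obtain c where c: "\<And>i. (\<lambda>k. x k $ i) \<longlonglongrightarrow> c"
    using assms(2) A(1) ergodic_chain_consensus
    unfolding absolutely_asymptotically_stable_def x_def by metis
  have "\<forall>\<^sub>F k in sequentially. \<forall>i. dist (x k $ i) c < 1/4"
    by (intro eventually_all_finite tendstoD[OF c]) simp
  then obtain k where k: "\<And>i. dist (x k $ i) c < 1/4"
    by (auto simp: eventually_sequentially)
  have "U k \<noteq> {}" "U k \<noteq> UNIV"
    using U[of k] by (auto simp: zero_flow_graph_def)
  then obtain i j where ij: "i \<in> U k" "j \<notin> U k"
    by auto
  have "\<bar>x k $ l - indicator (U k) l\<bar> \<le> 1/4" for l
    by (rule order_trans[OF close]) simp
  from this[of i] this[of j] have "\<bar>x k $ i - 1\<bar> \<le> 1/4" "\<bar>x k $ j\<bar> \<le> 1/4"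
    using ij by simp_all
  with k[of i] k[of j] show False
    unfolding dist_real_def by arith
qed

end
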